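(* For all $n\ge1$ and $0\le k\le n$, $$P_{1,k,2n}=\binom{n-1}{k}\binom{n}{k+1}(n!)^2\quad\text{and}\quad P_{0,k,2n}=\binom{n-1}{k}\binom{n}{k}(n!)^2.$$
   Context: $\mathcal{S}_m$ denotes the set of permutations $\sigma=\sigma_1\cdots\sigma_m$ of $\{1,\dots,m\}$. $\overrightarrow{des}_E(\sigma)$ is the number of indices $i\in\{1,\dots,m-1\}$ with $\sigma_i>\sigma_{i+1}$ and $\sigma_{i+1}$ even. For $j\in\{0,1\}$, $P_{j,k,m}$ is the number of $\sigma\in\mathcal{S}_m$ with $\overrightarrow{des}_E(\sigma)=k$ such that $\sigma_1$ is even if $j=1$ and $\sigma_1$ is odd if $j=0$. Binomial coefficients $\binom{a}{b}$ are $0$ when $b<0$ or $b>a$. *)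

theory Defs
  imports Main "HOL-Combinatorics.Permutations"
begin

text \<open>
  A permutation \<open>\<sigma> = \<sigma>\<^sub>1\<cdots>\<sigma>\<^sub>m\<close> of \<open>{1, \<dots>, m}\<close> is a function with \<open>\<sigma> permutes {1..m}\<close>; its
  \<open>i\<close>-th letter is \<open>\<sigma> i\<close>.
\<close>

definition des_E :: "nat \<Rightarrow> (nat \<Rightarrow> nat) \<Rightarrow> nat" where
  "des_E m \<sigma> = card {i \<in> {1..m - 1}. \<sigma> i > \<sigma> (i + 1) \<and> even (\<sigma> (i + 1))}"

text \<open>Only the values \<open>j = 0\<close> and \<open>j = 1\<close> are meaningful.\<close>

definition P :: "nat \<Rightarrow> nat \<Rightarrow> nat \<Rightarrow> nat" where
  "P j k m = card {\<sigma>. \<sigma> permutes {1..m} \<and> des_E m \<sigma> = k \<and>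
     (j = 1 \<longrightarrow> even (\<sigma> 1)) \<and> (j = 0 \<longrightarrow> odd (\<sigma> 1))}"

end

theory Submission
  imports Defs "HOL-Combinatorics.Multiset_Permutations"
begin

text \<open>
  Insert the letter \<open>m + 1\<close> into a permutation of \<open>{1, \<dots>, m}\<close>. The number of descents with even
  bottom grows by one exactly when the insertion takes place in front of an even letter that is not
  already a descent bottom, and is unchanged otherwise. Since there are \<open>m div 2\<close> even letters, this
  gives a linear recurrence in \<open>m\<close> for the numbers of permutations with a given number of such
  descents and a given parity of the first letter. The closed forms for \<open>m = 2n\<close> are proved together
  with
  \<open>P\<^sub>1\<^sub>,\<^sub>k\<^sub>,\<^sub>2\<^sub>n\<^sub>+\<^sub>1 = (n - k) (n choose k) (n + 1 choose k + 1) (n!)\<^sup>2\<close> and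
  \<open>P\<^sub>0\<^sub>,\<^sub>k\<^sub>,\<^sub>2\<^sub>n\<^sub>+\<^sub>1 = (n + 1) (n choose k)\<^sup>2 (n!)\<^sup>2\<close>.
\<close>

section \<open>Descents with even bottom on words, and insertion of a letter\<close>

fun even_descents :: "nat list \<Rightarrow> nat" where
  "even_descents (x # y # xs) = of_bool (y < x \<and> even y) + even_descents (y # xs)"
| "even_descents _ = 0"

definition insert_at :: "nat \<Rightarrow> 'a \<Rightarrow> 'a list \<Rightarrow> 'a list" where
  "insert_at i x xs = take i xs @ x # drop i xs"

lemma insert_at_0 [simp]: "insert_at 0 x xs = x # xs"
  by (simp add: insert_at_def)

lemma insert_at_Suc_Cons [simp]: "insert_at (Suc i) x (y # ys) = y # insert_at i x ys"
  by (simp add: insert_at_def)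

lemma insert_at_Nil [simp]: "insert_at i x [] = [x]"
  by (simp add: insert_at_def)

text \<open>The only occurrence of \<open>x\<close> marks where to cut the result back into prefix
  and suffix. The bounds matter since \<open>take\<close> truncates: they make the prefix length
  equal to the index.\<close>

lemma insert_at_eq_iff:
  assumes "x \<notin> set xs" "x \<notin> set ys" "i \<le> length xs" "j \<le> length ys"
  shows "insert_at i x xs = insert_at j x ys \<longleftrightarrow> i = j \<and> xs = ys"
proof
  assume eq: "insert_at i x xs = insert_at j x ys"
  have "x \<notin> set (take i xs)" "x \<notin> set (take j ys)"
    using assms(1,2) by (auto dest: in_set_takeD)
  moreover have "x \<notin> set (drop i xs)" "x \<notin> set (drop j ys)"
    using assms(1,2) by (auto dest: in_set_dropD)
  ultimately have *: "take i xs = take j ys" "drop i xs = drop j ys"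
    using eq unfolding insert_at_def by (auto simp: append_Cons_eq_iff)
  have "i = j" using arg_cong[OF *(1), of length] assms(3,4) by simp
  moreover have "xs = ys" using * by (metis append_take_drop_id)
  ultimately show "i = j \<and> xs = ys" ..
qed auto

lemma set_insert_at [simp]: "set (insert_at i x xs) = insert x (set xs)"
proof -
  have "set (take i xs) \<union> set (drop i xs) = set xs"
    by (metis append_take_drop_id set_append)
  then show ?thesis unfolding insert_at_def by auto
qed

lemma distinct_insert_at [simp]: "distinct (insert_at i x xs) \<longleftrightarrow> x \<notin> set xs \<and> distinct xs"
proof (induction xs arbitrary: i)
  case (Cons y ys)
  then show ?case by (cases i) auto
qed simp

text \<open>Injectivity comes from \<open>insert_at_eq_iff\<close>; surjectivity follows by
  counting, from n! * (n + 1) = (n + 1)!.\<close>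

lemma bij_betw_insert_at_permutations_of_set:
  assumes "finite A" "x \<notin> A"
  shows "bij_betw (\<lambda>(xs, i). insert_at i x xs) (permutations_of_set A \<times> {..card A})
           (permutations_of_set (insert x A))"
  unfolding bij_betw_def
proof
  let ?f = "\<lambda>(xs, i). insert_at i x xs"
  show inj: "inj_on ?f (permutations_of_set A \<times> {..card A})"
    using assms
    by (auto simp: inj_on_def insert_at_eq_iff length_finite_permutations_of_set
        permutations_of_setD)
  show "?f ` (permutations_of_set A \<times> {..card A}) = permutations_of_set (insert x A)"
  proof (rule card_subset_eq)
    show "?f ` (permutations_of_set A \<times> {..card A}) \<subseteq> permutations_of_set (insert x A)"
      using assms by (auto simp: permutations_of_set_def)
    show "card (?f ` (permutations_of_set A \<times> {..card A})) = card (permutations_of_set (insert x A))"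
      using assms by (simp add: card_image[OF inj] card_cartesian_product)
  qed (use assms in simp)
qed

section \<open>Inserting a new largest letter\<close>

text \<open>Between neighbours p and c, the letter \<open>M\<close> creates no descent after p and a
  descent onto c, which counts iff c is even. The pair (p, c) may already have counted, so the gain
  is 0 or 1. Keeping \<open>a\<close> in front excludes the insertion that changes the first
  letter.\<close>

lemma even_descents_insert_at_cases:
  assumes "i \<le> length xs" "\<And>x. x \<in> set (a # xs) \<Longrightarrow> x < M"
  shows "even_descents (a # insert_at i M xs) = even_descents (a # xs) \<or>
         even_descents (a # insert_at i M xs) = Suc (even_descents (a # xs))"
  using assms
proof (induction xs arbitrary: i a)
  case Nil
  then show ?case by auto
next
  case (Cons b ys)
  show ?case
  proof (cases i)
    case 0
    have "a < M" "b < M" using Cons.prems(2) by auto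
    then show ?thesis using 0 by auto
  next
    case (Suc i')
    then show ?thesis using Cons.IH[of i' b] Cons.prems by auto
  qed
qed

text \<open>The gaps that raise the count lie in front of the even letters of \<open>xs\<close> that
  are not yet descent bottoms, and every counted descent of \<open>a # xs\<close> has its bottom in
  \<open>xs\<close>. The additive form avoids subtraction of naturals.\<close>

lemma sum_even_descents_insert_at:
  assumes "\<And>x. x \<in> set (a # xs) \<Longrightarrow> x < M"
  shows "(\<Sum>i\<le>length xs. of_bool (even_descents (a # insert_at i M xs) =
            Suc (even_descents (a # xs)))) + even_descents (a # xs) = length (filter even xs)"
  using assms
proof (induction xs arbitrary: a)
  case Nil
  then show ?case by auto
next
  case (Cons b ys)
  then have IH: "(\<Sum>i\<le>length ys. of_bool (even_descents (b # insert_at i M ys) =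
            Suc (even_descents (b # ys)))) + even_descents (b # ys) = length (filter even ys)"
    by simp
  have "b < M" "a < M" using Cons.prems by auto
  then show ?case using IH
    by (simp add: sum.atMost_Suc_shift del: sum.atMost_Suc)
qed

lemma sum_even_descents_insert_at_eq:
  fixes k :: int
  assumes "\<And>x. x \<in> set (a # xs) \<Longrightarrow> x < M"
  defines "d \<equiv> int (even_descents (a # xs))" and "e \<equiv> int (length (filter even xs))"
  shows "(\<Sum>i\<le>length xs. of_bool (int (even_descents (a # insert_at i M xs)) = k)) =
    (int (length xs) + 1 - e + k) * of_bool (d = k) + (e - k + 1) * of_bool (d = k - 1)"
proof -
  define g where "g i = (of_bool (even_descents (a # insert_at i M xs) =
            Suc (even_descents (a # xs))) :: int)" for i
  have g: "(\<Sum>i\<le>length xs. g i) = e - d"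
  proof -
    have "int (\<Sum>i\<le>length xs. of_bool (even_descents (a # insert_at i M xs) =
            Suc (even_descents (a # xs)))) + d = e"
      unfolding d_def e_def using sum_even_descents_insert_at[OF assms(1)] by (metis of_nat_add)
    then show ?thesis by (simp add: g_def)
  qed
  have "(\<Sum>i\<le>length xs. of_bool (int (even_descents (a # insert_at i M xs)) = k)) =
        (\<Sum>i\<le>length xs. of_bool (d = k) * (1 - g i) + of_bool (d = k - 1) * g i)"
  proof (rule sum.cong)
    fix i assume "i \<in> {..length xs}"
    then show "of_bool (int (even_descents (a # insert_at i M xs)) = k) =
        of_bool (d = k) * (1 - g i) + of_bool (d = k - 1) * g i"
      using even_descents_insert_at_cases[of i xs a M, OF _ assms(1)]
      by (auto simp: g_def d_def of_bool_def)
  qed simp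
  also have "\<dots> = of_bool (d = k) * (int (length xs) + 1 - (e - d)) + of_bool (d = k - 1) * (e - d)"
    by (simp add: sum.distrib sum_subtractf g flip: sum_distrib_left)
  \<comment> \<open>Each indicator fixes \<open>d\<close>, so the coefficients can be written in
    \<open>k\<close> alone; they then become constants when summing over all words.\<close>
  also have "\<dots> = (int (length xs) + 1 - e + k) * of_bool (d = k) + (e - k + 1) * of_bool (d = k - 1)"
    by (auto simp: of_bool_def)
  finally show ?thesis .
qed

section \<open>The recurrence in the number of letters\<close>

text \<open>
  The number of descents is an integer here, so that the recurrence below needs no case distinction
  on \<open>k = 0\<close>; the flag \<open>j\<close> says whether the first letter is even.
\<close>

definition even_descent_count :: "bool \<Rightarrow> int \<Rightarrow> nat \<Rightarrow> int" where
  "even_descent_count j k m =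
     int (card {xs \<in> permutations_of_set {1..m}. int (even_descents xs) = k \<and> even (hd xs) = j})"

lemma even_descent_count_eq_sum:
  "even_descent_count j k m = (\<Sum>xs\<in>permutations_of_set {1..m}.
     of_bool (int (even_descents xs) = k \<and> even (hd xs) = j))"
  unfolding even_descent_count_def by (simp add: sum_of_bool_eq Int_def)

lemma card_even_atLeastAtMost: "card {x \<in> {1..m}. even x} = m div 2" for m :: nat
proof (induction m)
  case (Suc m)
  have "{x \<in> {1..Suc m}. even x} = (if even (Suc m) then insert (Suc m) else id) {x \<in> {1..m}. even x}"
    by (auto simp: le_Suc_eq)
  then show ?case using Suc by (auto elim!: oddE)
qed simp

lemma length_filter_even_permutation:
  assumes "xs \<in> permutations_of_set {1..m}"
  shows "length (filter even xs) = m div 2"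
proof -
  have "length (filter even xs) = card (set (filter even xs))"
    using assms by (metis distinct_card distinct_filter permutations_of_setD(2))
  also have "\<dots> = m div 2"
    using permutations_of_setD(1)[OF assms] card_even_atLeastAtMost[of m] by simp
  finally show ?thesis .
qed

text \<open>Insertion behind the first letter b keeps the class \<open>j\<close>: there are
  \<open>m\<close> such gaps, and the tail has \<open>e\<close> even letters, less one if b is even.
  Insertion in front gives a word whose first letter is even iff \<open>m\<close> is odd, with a new
  counted descent iff b is even; this is the last summand.\<close>

lemma even_descent_count_Suc:
  assumes "m \<ge> 1"
  defines "e \<equiv> int (m div 2)"
  shows "even_descent_count j k (Suc m) =
    (int m - e + k + of_bool j) * even_descent_count j k m +
    (e - k + 1 - of_bool j) * even_descent_count j (k - 1) m +
    of_bool (odd m = j) * (even_descent_count True (k - 1) m + even_descent_count False k m)"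
proof -
  let ?L = "permutations_of_set {1..m}"
  let ?Q = "\<lambda>xs. of_bool (int (even_descents xs) = k \<and> even (hd xs) = j) :: int"
  let ?B = "\<lambda>j k xs. of_bool (int (even_descents xs) = k \<and> even (hd xs) = j) :: int"
  have "{1..Suc m} = insert (Suc m) {1..m}" by auto
  then have bij: "bij_betw (\<lambda>(xs, i). insert_at i (Suc m) xs) (?L \<times> {..m})
      (permutations_of_set {1..Suc m})"
    using bij_betw_insert_at_permutations_of_set[of "{1..m}" "Suc m"] by simp
  have "even_descent_count j k (Suc m) = (\<Sum>xs\<in>?L. \<Sum>i\<le>m. ?Q (insert_at i (Suc m) xs))"
    unfolding even_descent_count_eq_sum
    by (subst sum.reindex_bij_betw[OF bij, symmetric])
      (unfold sum.cartesian_product, intro sum.cong, auto)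
  also have "\<dots> = (\<Sum>xs\<in>?L.
      (int m - e + k + of_bool j) * ?B j k xs + (e - k + 1 - of_bool j) * ?B j (k - 1) xs +
      of_bool (odd m = j) * (?B True (k - 1) xs + ?B False k xs))"
  proof (rule sum.cong)
    fix xs assume xs: "xs \<in> ?L"
    then have len: "length xs = m"
      by (simp add: length_finite_permutations_of_set)
    then obtain b ys where bys: "xs = b # ys" using assms(1) by (cases xs) auto
    have less: "x < Suc m" if "x \<in> set (b # ys)" for x
      using that permutations_of_setD(1)[OF xs] unfolding bys
      by (metis atLeastAtMost_iff le_imp_less_Suc)
    have e: "int (length (filter even ys)) = e - of_bool (even b)"
      using length_filter_even_permutation[OF xs] bys by (auto simp: e_def)
    have m: "m = Suc (length ys)" using len bys by simp
    \<comment> \<open>The index 0, insertion in front, is split off; all other insertions keep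
      \<open>b\<close> first.\<close>
    have "(\<Sum>i\<le>m. ?Q (insert_at i (Suc m) xs)) = ?Q (Suc m # xs) +
      of_bool (even b = j) *
        (\<Sum>i\<le>length ys. of_bool (int (even_descents (b # insert_at i (Suc m) ys)) = k))"
      by (subst (1) m, subst sum.atMost_Suc_shift)
        (auto simp: bys sum_distrib_left intro!: sum.cong)
    also have "?Q (Suc m # xs) = of_bool (odd m = j) * (?B True (k - 1) xs + ?B False k xs)"
      using less[of b] bys by (auto simp: of_bool_def)
    also have "(\<Sum>i\<le>length ys. of_bool (int (even_descents (b # insert_at i (Suc m) ys)) = k)) =
      (int m - e + of_bool (even b) + k) * of_bool (int (even_descents xs) = k) +
      (e - of_bool (even b) - k + 1) * of_bool (int (even_descents xs) = k - 1)"
      by (subst sum_even_descents_insert_at_eq, erule less) (simp add: e bys m algebra_simps)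
    \<comment> \<open>The factor \<open>of_bool (even b = j)\<close> permits replacing
      \<open>even b\<close> by \<open>j\<close> in the coefficients.\<close>
    finally show "(\<Sum>i\<le>m. ?Q (insert_at i (Suc m) xs)) =
      (int m - e + k + of_bool j) * ?B j k xs + (e - k + 1 - of_bool j) * ?B j (k - 1) xs +
      of_bool (odd m = j) * (?B True (k - 1) xs + ?B False k xs)"
      by (auto simp: bys)
  qed simp
  also have "\<dots> = (int m - e + k + of_bool j) * even_descent_count j k m +
    (e - k + 1 - of_bool j) * even_descent_count j (k - 1) m +
    of_bool (odd m = j) * (even_descent_count True (k - 1) m + even_descent_count False k m)"
    unfolding even_descent_count_eq_sum by (simp only: sum.distrib flip: sum_distrib_left)
  finally show ?thesis .
qed

lemma even_descent_count_1: "even_descent_count j k (Suc 0) = of_bool (\<not> j \<and> k = 0)"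
proof -
  have "permutations_of_set {1..Suc 0} = {[1]}" by simp
  then show ?thesis unfolding even_descent_count_eq_sum by auto
qed

section \<open>From words back to permutations as functions\<close>

text \<open>\<open>even_descents\<close> recurses from the left, but the index set of
  \<open>des_E\<close> grows at its right end.\<close>

lemma even_descents_append1:
  "xs \<noteq> [] \<Longrightarrow> even_descents (xs @ [y]) = even_descents xs + of_bool (y < last xs \<and> even y)"
  by (induction xs rule: even_descents.induct) auto

lemma even_descents_map_upt:
  assumes "m \<ge> 1"
  shows "even_descents (map \<sigma> [1..<Suc m]) = des_E m \<sigma>"
  using assms
proof (induction m rule: dec_induct)
  case base
  then show ?case by (simp add: des_E_def)
next
  case (step m)
  have "{i \<in> {1..Suc m - 1}. \<sigma> i > \<sigma> (i + 1) \<and> even (\<sigma> (i + 1))} =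
    (if \<sigma> (Suc m) < \<sigma> m \<and> even (\<sigma> (Suc m)) then insert m else id)
      {i \<in> {1..m - 1}. \<sigma> i > \<sigma> (i + 1) \<and> even (\<sigma> (i + 1))}"
    using step(1) by (auto simp: le_less)
  then have "des_E (Suc m) \<sigma> = des_E m \<sigma> + of_bool (\<sigma> (Suc m) < \<sigma> m \<and> even (\<sigma> (Suc m)))"
    using step(1) unfolding des_E_def by (auto simp: card_insert_if)
  moreover have "map \<sigma> [1..<Suc (Suc m)] = map \<sigma> [1..<Suc m] @ [\<sigma> (Suc m)]"
    by simp
  moreover have "map \<sigma> [1..<Suc m] \<noteq> []" "last (map \<sigma> [1..<Suc m]) = \<sigma> m"
    using step(1) by auto
  ultimately show ?case using step even_descents_append1 by metis
qed

text \<open>A permutation is the identity outside \<open>{1..m}\<close>, so its word determines it;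
  both sets have m! elements, which gives surjectivity.\<close>

lemma bij_betw_permutes_permutations_of_set:
  "bij_betw (\<lambda>\<sigma>. map \<sigma> [1..<Suc m]) {\<sigma>. \<sigma> permutes {1..m}} (permutations_of_set {1..m})"
  unfolding bij_betw_def
proof
  let ?f = "\<lambda>\<sigma>. map \<sigma> [1..<Suc m]"
  have upt: "set [1..<Suc m] = {1..m}" by auto
  show inj: "inj_on ?f {\<sigma>. \<sigma> permutes {1..m}}"
  proof (rule inj_onI)
    fix \<sigma> \<tau> assume perm: "\<sigma> \<in> {\<sigma>. \<sigma> permutes {1..m}}" "\<tau> \<in> {\<sigma>. \<sigma> permutes {1..m}}"
      and "?f \<sigma> = ?f \<tau>"
    then have "\<forall>x\<in>{1..m}. \<sigma> x = \<tau> x" unfolding map_eq_conv upt by simp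
    with perm show "\<sigma> = \<tau>" by (metis ext mem_Collect_eq permutes_not_in)
  qed
  show "?f ` {\<sigma>. \<sigma> permutes {1..m}} = permutations_of_set {1..m}"
  proof (rule card_subset_eq)
    show "?f ` {\<sigma>. \<sigma> permutes {1..m}} \<subseteq> permutations_of_set {1..m}"
    proof safe
      fix \<sigma> assume \<sigma>: "\<sigma> permutes {1..m}"
      show "?f \<sigma> \<in> permutations_of_set {1..m}"
      proof (rule permutations_of_setI)
        show "set (?f \<sigma>) = {1..m}"
          unfolding set_map upt by (rule permutes_image[OF \<sigma>])
        show "distinct (?f \<sigma>)"
          unfolding distinct_map using permutes_inj_on[OF \<sigma>] by simp
      qed
    qed
    show "card (?f ` {\<sigma>. \<sigma> permutes {1..m}}) = card (permutations_of_set {1..m})"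
      unfolding card_image[OF inj] by (simp add: card_permutations[of _ m])
  qed simp
qed

lemma P_eq_even_descent_count:
  assumes "m \<ge> 1" "j < 2"
  shows "int (P j k m) = even_descent_count (j = 1) (int k) m"
proof -
  let ?f = "\<lambda>\<sigma>. map \<sigma> [1..<Suc m]"
  let ?A = "{\<sigma>. \<sigma> permutes {1..m}}"
  let ?R = "\<lambda>xs. int (even_descents xs) = int k \<and> even (hd xs) = (j = 1)"
  have hd: "hd (?f \<sigma>) = \<sigma> 1" for \<sigma> :: "nat \<Rightarrow> nat"
    using assms(1) by (simp add: hd_map hd_upt del: upt_Suc)
  have "{\<sigma>. \<sigma> permutes {1..m} \<and> des_E m \<sigma> = k \<and>
     (j = 1 \<longrightarrow> even (\<sigma> 1)) \<and> (j = 0 \<longrightarrow> odd (\<sigma> 1))} = {\<sigma> \<in> ?A. ?R (?f \<sigma>)}"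
    using assms unfolding hd even_descents_map_upt[OF assms(1)] by (auto simp: less_2_cases_iff)
  moreover have "bij_betw ?f {\<sigma> \<in> ?A. ?R (?f \<sigma>)} {xs \<in> permutations_of_set {1..m}. ?R xs}"
    using bij_betw_permutes_permutations_of_set[of m]
    unfolding bij_betw_def inj_on_def by blast
  ultimately show ?thesis
    unfolding P_def even_descent_count_def by (metis (no_types, lifting) bij_betw_same_card)
qed

section \<open>Binomial coefficients with integer lower index\<close>

text \<open>The zero branch is essential: \<open>nat\<close> sends negative \<open>k\<close> to 0,
  which would give the value 1. With it, Pascal's rule and absorption hold for every integer
  \<open>k\<close>.\<close>

definition int_binomial :: "nat \<Rightarrow> int \<Rightarrow> int" where
  "int_binomial n k = (if k < 0 then 0 else int (n choose nat k))"

lemma int_binomial_of_nat [simp]: "int_binomial n (int k) = int (n choose k)"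
  by (simp add: int_binomial_def)

lemma int_binomial_0: "int_binomial 0 k = of_bool (k = 0)"
  by (auto simp: int_binomial_def)

lemma int_binomial_Suc: "int_binomial (Suc n) k = int_binomial n k + int_binomial n (k - 1)"
proof (cases "k \<le> 0")
  case False
  then obtain l where "k = int (Suc l)"
    by (metis not_le pos_int_cases Suc_pred)
  then show ?thesis by (simp del: of_nat_Suc add: int_binomial_def nat_diff_distrib)
qed (auto simp: int_binomial_def)

text \<open>In the induction step, Pascal's rule and the hypothesis at \<open>k\<close> and
  \<open>k - 1\<close> reduce both sides to
  \<open>(int n + 1) * int_binomial n (k - 1)\<close>.\<close>

lemma int_binomial_absorb:
  "k * int_binomial n k = (int n - k + 1) * int_binomial n (k - 1)"
proof (induction n arbitrary: k)
  case 0
  then show ?case by (auto simp: int_binomial_0)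
next
  case (Suc n)
  have "k * int_binomial n k = (int n - k + 1) * int_binomial n (k - 1)"
    "(k - 1) * int_binomial n (k - 1) = (int n - (k - 1) + 1) * int_binomial n (k - 1 - 1)"
    by (rule Suc)+
  then show ?case by (simp add: int_binomial_Suc algebra_simps)
qed

section \<open>Closed forms by induction\<close>

text \<open>The new letter \<open>2 * n + 2\<close> is even, so insertion in front contributes only
  to the class \<open>True\<close>. Absorption relates neighbouring binomials and turns the
  recurrence into a polynomial identity.\<close>

lemma even_descent_count_even_step:
  fixes n :: nat
  assumes T: "\<And>k. even_descent_count True k (2 * n + 1) =
      (int n - k) * int_binomial n k * int_binomial (Suc n) (k + 1) * (fact n)\<^sup>2"
    and F: "\<And>k. even_descent_count False k (2 * n + 1) =
      (int n + 1) * (int_binomial n k)\<^sup>2 * (fact n)\<^sup>2"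
  shows "even_descent_count True k (2 * Suc n) =
      int_binomial n k * int_binomial (Suc n) (k + 1) * (fact (Suc n))\<^sup>2"
    and "even_descent_count False k (2 * Suc n) =
      int_binomial n k * int_binomial (Suc n) k * (fact (Suc n))\<^sup>2"
proof -
  have m: "2 * Suc n = Suc (2 * n + 1)" by simp
  define N f x y z where "N = int n" and "f = (fact n :: int)\<^sup>2" and "x = int_binomial n k"
    and "y = int_binomial n (k - 1)" and "z = int_binomial n (k + 1)"
  note defs = N_def[symmetric] f_def[symmetric] x_def[symmetric] y_def[symmetric] z_def[symmetric]
  have f: "(fact (Suc n) :: int)\<^sup>2 = (N + 1)\<^sup>2 * f"
    by (simp add: N_def f_def power_mult_distrib add.commute)
  have y: "k * x = (N - k + 1) * y"
    using int_binomial_absorb[of k n] by (simp add: defs)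
  have z: "(k + 1) * z = (N - k) * x"
    using int_binomial_absorb[of "k + 1" n] by (simp add: defs)
  have S: "int_binomial (Suc n) k = x + y" "int_binomial (Suc n) (k + 1) = z + x"
    by (simp_all add: int_binomial_Suc defs)
  have "even_descent_count True k (2 * Suc n) =
      (N + k + 2) * even_descent_count True k (2 * n + 1) +
      (N - k + 1) * even_descent_count True (k - 1) (2 * n + 1) +
      even_descent_count False k (2 * n + 1)"
    unfolding m by (subst even_descent_count_Suc) (simp_all add: N_def algebra_simps)
  also have "\<dots> = (N + k + 2) * ((N - k) * x * (z + x) * f) +
      (N - k + 1) * ((N - k + 1) * y * (x + y) * f) + (N + 1) * x\<^sup>2 * f"
    unfolding T F diff_add_cancel S defs by (simp add: algebra_simps)
  \<comment> \<open>By \<open>y\<close> the last two summands add up to (k + 1)(N + 1)x^2 f, which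
    by \<open>z\<close> is (k + 1)^2 x(z + x) f; and (N + k + 2)(N - k) = (N + 1)^2 - (k +
    1)^2.\<close>
  also have "\<dots> = x * (z + x) * ((N + 1)\<^sup>2 * f)"
    using y z by algebra
  finally show "even_descent_count True k (2 * Suc n) =
      int_binomial n k * int_binomial (Suc n) (k + 1) * (fact (Suc n))\<^sup>2"
    unfolding f S defs .
  have "even_descent_count False k (2 * Suc n) =
      (N + k + 1) * even_descent_count False k (2 * n + 1) +
      (N - k + 1) * even_descent_count False (k - 1) (2 * n + 1)"
    unfolding m by (subst even_descent_count_Suc) (simp_all add: N_def algebra_simps)
  also have "\<dots> = (N + k + 1) * ((N + 1) * x\<^sup>2 * f) + (N - k + 1) * ((N + 1) * y\<^sup>2 * f)"
    unfolding F defs ..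
  also have "\<dots> = x * (x + y) * ((N + 1)\<^sup>2 * f)"
    using y by algebra
  finally show "even_descent_count False k (2 * Suc n) =
      int_binomial n k * int_binomial (Suc n) k * (fact (Suc n))\<^sup>2"
    unfolding f S defs .
qed

text \<open>Now the new letter is odd, so insertion in front contributes only to the class
  \<open>False\<close>, from both classes.\<close>

lemma even_descent_count_odd_step:
  fixes n :: nat
  assumes T: "\<And>k. even_descent_count True k (2 * Suc n) =
      int_binomial n k * int_binomial (Suc n) (k + 1) * (fact (Suc n))\<^sup>2"
    and F: "\<And>k. even_descent_count False k (2 * Suc n) =
      int_binomial n k * int_binomial (Suc n) k * (fact (Suc n))\<^sup>2"
  shows "even_descent_count True k (2 * Suc n + 1) =
      (int (Suc n) - k) * int_binomial (Suc n) k * int_binomial (Suc (Suc n)) (k + 1) *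
      (fact (Suc n))\<^sup>2"
    and "even_descent_count False k (2 * Suc n + 1) =
      (int (Suc n) + 1) * (int_binomial (Suc n) k)\<^sup>2 * (fact (Suc n))\<^sup>2"
proof -
  have m: "2 * Suc n + 1 = Suc (2 * Suc n)" by simp
  \<comment> \<open>Here \<open>N\<close> is n + 1 while the binomials keep the upper index n, hence
    the shifted coefficients in the absorption relations. \<open>t\<close> enters through the class
    \<open>False\<close> at \<open>k - 1\<close>.\<close>
  define N f x y z t where "N = int (Suc n)" and "f = (fact (Suc n) :: int)\<^sup>2"
    and "x = int_binomial n k" and "y = int_binomial n (k - 1)"
    and "z = int_binomial n (k + 1)" and "t = int_binomial n (k - 2)"
  note defs = N_def[symmetric] f_def[symmetric] x_def[symmetric] y_def[symmetric] z_def[symmetric]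
    t_def[symmetric]
  have y: "k * x = (N - k) * y"
    using int_binomial_absorb[of k n] by (simp add: N_def x_def y_def algebra_simps)
  have z: "(k + 1) * z = (N - k - 1) * x"
    using int_binomial_absorb[of "k + 1" n] by (simp add: N_def x_def z_def algebra_simps)
  have t: "(k - 1) * y = (N - k + 1) * t"
    using int_binomial_absorb[of "k - 1" n] by (simp add: N_def y_def t_def algebra_simps)
  have S: "int_binomial (Suc n) k = x + y" "int_binomial (Suc n) (k + 1) = z + x"
    "int_binomial (Suc n) (k - 1) = y + t" "int_binomial (Suc (Suc n)) (k + 1) = z + x + (x + y)"
    by (simp_all add: int_binomial_Suc defs)
  have "even_descent_count True k (2 * Suc n + 1) =
      (N + k + 1) * even_descent_count True k (2 * Suc n) +
      (N - k) * even_descent_count True (k - 1) (2 * Suc n)"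
    unfolding m by (subst even_descent_count_Suc) (simp_all add: N_def algebra_simps)
  also have "\<dots> = (N + k + 1) * (x * (z + x) * f) + (N - k) * (y * (x + y) * f)"
    unfolding T diff_add_cancel S defs ..
  also have "\<dots> = (N - k) * (x + y) * (z + x + (x + y)) * f"
    using y z by algebra
  finally show "even_descent_count True k (2 * Suc n + 1) =
      (int (Suc n) - k) * int_binomial (Suc n) k * int_binomial (Suc (Suc n)) (k + 1) *
      (fact (Suc n))\<^sup>2"
    unfolding S defs .
  have "even_descent_count False k (2 * Suc n + 1) =
      (N + k + 1) * even_descent_count False k (2 * Suc n) +
      (N - k + 1) * even_descent_count False (k - 1) (2 * Suc n) +
      even_descent_count True (k - 1) (2 * Suc n)"
    unfolding m by (subst even_descent_count_Suc) (simp_all add: N_def algebra_simps)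
  also have "\<dots> = (N + k + 1) * (x * (x + y) * f) + (N - k + 1) * (y * (y + t) * f) +
      y * (x + y) * f"
    unfolding T F diff_add_cancel S defs ..
  also have "\<dots> = (N + 1) * (x + y)\<^sup>2 * f"
    using y t by algebra
  finally show "even_descent_count False k (2 * Suc n + 1) =
      (int (Suc n) + 1) * (int_binomial (Suc n) k)\<^sup>2 * (fact (Suc n))\<^sup>2"
    unfolding S defs .
qed

text \<open>The induction runs over odd lengths from the one-letter word, each step passing through
  the even length between. It needs all \<open>k\<close> at once, as the recurrence also uses
  \<open>k - 1\<close>.\<close>

lemma even_descent_count_odd:
  "even_descent_count True k (2 * n + 1) =
     (int n - k) * int_binomial n k * int_binomial (Suc n) (k + 1) * (fact n)\<^sup>2"
  "even_descent_count False k (2 * n + 1) = (int n + 1) * (int_binomial n k)\<^sup>2 * (fact n)\<^sup>2"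
proof (induction n arbitrary: k)
  case 0
  {
    case 1
    show ?case by (simp add: even_descent_count_1 int_binomial_0)
  next
    case 2
    show ?case by (simp add: even_descent_count_1 int_binomial_0)
  }
next
  case (Suc n)
  note even = even_descent_count_even_step[OF Suc.IH]
  {
    case 1
    show ?case by (rule even_descent_count_odd_step(1)[OF even])
  next
    case 2
    show ?case by (rule even_descent_count_odd_step(2)[OF even])
  }
qed

theorem theorem4p6:
  fixes n k :: nat
  assumes "n \<ge> 1" and "k \<le> n"
  shows "P 1 k (2 * n) = ((n - 1) choose k) * (n choose (k + 1)) * (fact n)\<^sup>2 \<and>
         P 0 k (2 * n) = ((n - 1) choose k) * (n choose k) * (fact n)\<^sup>2"
proof -
  \<comment> \<open>The even-length formulas are stated for \<open>2 * Suc p\<close>, so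
    \<open>n - 1\<close> becomes \<open>p\<close>.\<close>
  obtain p where n: "n = Suc p" using assms(1) by (cases n) auto
  note even = even_descent_count_even_step[OF even_descent_count_odd, where k = "int k"]
  have k: "int k + 1 = int (k + 1)" by simp
  have "int (P 1 k (2 * n)) = int (((n - 1) choose k) * (n choose (k + 1)) * (fact n)\<^sup>2)"
    using P_eq_even_descent_count[of "2 * n" 1 k] even(1) unfolding n k int_binomial_of_nat
    by (simp del: binomial_Suc_Suc fact_Suc)
  moreover have "int (P 0 k (2 * n)) = int (((n - 1) choose k) * (n choose k) * (fact n)\<^sup>2)"
    using P_eq_even_descent_count[of "2 * n" 0 k] even(2) unfolding n int_binomial_of_nat
    by (simp del: binomial_Suc_Suc fact_Suc)
  ultimately show ?thesis unfolding of_nat_eq_iff ..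
qed

end
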